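(* If $p\geq 3$ is a prime, then for all integers $n\geq 0$, $\alpha\geq 0$, $\delta\geq 0$, $k\geq 1$ and all $t\in\{1,2,\ldots,p-1\}$, $$\overline{OPT}_{2k+1}\left(2\cdot 3^{2\alpha}\cdot p^{2\delta+1}(pn+t)+3^{2\alpha}\cdot p^{2(\delta+1)}\right)\equiv 0 \pmod 4.$$
   Context: An overpartition of a nonnegative integer $n$ is a non-increasing sequence of positive integers with sum $n$ in which the first occurrence of each number may be overlined. For an integer $k\geq 1$, an overpartition $k$-tuple of $n$ with odd parts is an (ordered) $k$-tuple $(\xi_1,\ldots,\xi_k)$ of overpartitions, all of whose parts are odd, such that the sum of all the parts of $\xi_1,\ldots,\xi_k$ is $n$. $\overline{OPT}_k(n)$ denotes the number of overpartition $k$-tuples of $n$ with odd parts. Its generating function is $$\sum_{n\geq 0}\overline{OPT}_k(n)q^n=\frac{f_2^{3k}}{f_1^{2k}f_4^k}=\prod_{i\geq 0}\left(\frac{1+q^{2i+1}}{1-q^{2i+1}}\right)^k,\qquad f_j:=\prod_{i\geq 1}(1-q^{ji}).$$ *)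

theory Defs
  imports "HOL-Number_Theory.Cong"
begin

text \<open>
  A list entry \<open>(m, b)\<close> is a part of size \<open>m\<close>, overlined iff \<open>b\<close>.
\<close>

definition overpartition :: "nat \<Rightarrow> (nat \<times> bool) list \<Rightarrow> bool" where
  "overpartition n xs \<longleftrightarrow>
     sorted_wrt (\<ge>) (map fst xs) \<and>
     (\<forall>x\<in>set xs. fst x > 0) \<and>
     (\<forall>i<length xs. snd (xs ! i) \<longrightarrow> (\<forall>j<i. fst (xs ! j) \<noteq> fst (xs ! i))) \<and>
     sum_list (map fst xs) = n"

definition odd_parts :: "(nat \<times> bool) list \<Rightarrow> bool" where
  "odd_parts xs \<longleftrightarrow> (\<forall>x\<in>set xs. odd (fst x))"

definition overpartition_tuples_odd :: "nat \<Rightarrow> nat \<Rightarrow> (nat \<times> bool) list list set" where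
  "overpartition_tuples_odd k n =
     {\<xi>s. length \<xi>s = k \<and>
          (\<forall>\<xi>\<in>set \<xi>s. \<exists>m. overpartition m \<xi> \<and> odd_parts \<xi>) \<and>
          (\<Sum>\<xi>\<leftarrow>\<xi>s. sum_list (map fst \<xi>)) = n}"

definition OPT :: "nat \<Rightarrow> nat \<Rightarrow> nat" where
  "OPT k n = card (overpartition_tuples_odd k n)"

text \<open>\<^const>\<open>card\<close> is 0 on infinite sets; this does not occur here.\<close>

lemma overpartition_bounded:
  assumes "overpartition m xs"
  shows "length xs \<le> m" and "set xs \<subseteq> {..m} \<times> UNIV"
proof -
  have pos: "\<forall>x\<in>set xs. fst x > 0" and m: "sum_list (map fst xs) = m"
    using assms by (auto simp: overpartition_def)
  have "length xs \<le> sum_list (map fst xs)"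
    using pos by (induction xs) auto
  then show "length xs \<le> m" using m by simp
  have "fst x \<le> m" if "x \<in> set xs" for x
    using that member_le_sum_list[of "fst x" "map fst xs"] m by auto
  then show "set xs \<subseteq> {..m} \<times> UNIV" by auto
qed

lemma finite_overpartition_tuples_odd: "finite (overpartition_tuples_odd k n)"
proof -
  let ?A = "{xs. set xs \<subseteq> {..n} \<times> (UNIV :: bool set) \<and> length xs \<le> n}"
  have "overpartition_tuples_odd k n \<subseteq> {\<xi>s. set \<xi>s \<subseteq> ?A \<and> length \<xi>s = k}"
  proof
    fix \<xi>s assume \<xi>s: "\<xi>s \<in> overpartition_tuples_odd k n"
    have "\<xi> \<in> ?A" if \<xi>: "\<xi> \<in> set \<xi>s" for \<xi>
    proof -
      obtain m where m: "overpartition m \<xi>"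
        using \<xi>s \<xi> by (auto simp: overpartition_tuples_odd_def)
      have "m \<le> n"
        using \<xi>s \<xi> m member_le_sum_list[of m "map (\<lambda>\<xi>. sum_list (map fst \<xi>)) \<xi>s"]
        by (auto simp: overpartition_tuples_odd_def overpartition_def)
      with overpartition_bounded[OF m] show ?thesis by fastforce
    qed
    with \<xi>s show "\<xi>s \<in> {\<xi>s. set \<xi>s \<subseteq> ?A \<and> length \<xi>s = k}"
      by (auto simp: overpartition_tuples_odd_def)
  qed
  moreover have "finite {\<xi>s. set \<xi>s \<subseteq> ?A \<and> length \<xi>s = k}"
    by (intro finite_lists_length_eq finite_lists_length_le) simp
  ultimately show ?thesis by (rule finite_subset)
qed

end

theory Submission
  imports Defs
begin

text \<open>
  A partition with \<open>d\<close> distinct part sizes underlies exactly \<open>2 ^ d\<close> overpartitions. Hence,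
  modulo 4, only the tuples in which a single part size occurs altogether survive, and for odd
  \<open>n > 0\<close> the number of \<open>k\<close>-tuples is congruent to \<open>2 k \<tau>(n)\<close> with \<open>\<tau>\<close> the divisor-counting
  function. The argument in the theorem is odd and its \<open>p\<close>-adic valuation is odd, so it is not a
  square and \<open>\<tau>\<close> takes an even value there.
\<close>

section \<open>Overlinings of a fixed list of part sizes\<close>

text \<open>The fibre over \<open>ys\<close> when bars are forgotten: only the overlining clause of
  \<open>overpartition\<close> is kept, and the conditions on the sizes alone go to
  \<open>odd_partitions\<close>.\<close>

definition overlinings :: "nat list \<Rightarrow> (nat \<times> bool) list set" where
  "overlinings ys = {xs. map fst xs = ys \<and>
     (\<forall>i<length xs. snd (xs ! i) \<longrightarrow> (\<forall>j<i. fst (xs ! j) \<noteq> fst (xs ! i)))}"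

text \<open>Positivity of the parts is implied by oddness.\<close>

definition odd_partitions :: "nat \<Rightarrow> nat list set" where
  "odd_partitions n = {ys. sorted_wrt (\<ge>) ys \<and> (\<forall>y\<in>set ys. odd y) \<and> sum_list ys = n}"

definition odd_overpartitions :: "nat \<Rightarrow> (nat \<times> bool) list set" where
  "odd_overpartitions n = {xs. overpartition n xs \<and> odd_parts xs}"

text \<open>The overlining clause looks only at earlier entries, so appending an entry leaves the
  conditions on \<open>xs\<close> unchanged and adds one on its own bar.\<close>

lemma snoc_mem_overlinings_iff:
  "xs @ [(y, b)] \<in> overlinings (ys @ [y']) \<longleftrightarrow>
     xs \<in> overlinings ys \<and> y = y' \<and> (b \<longrightarrow> y \<notin> set ys)"
proof -
  have "(\<forall>j<length xs. fst (xs ! j) \<noteq> y) \<longleftrightarrow> y \<notin> fst ` set xs"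
    by (metis (no_types, lifting) image_iff in_set_conv_nth)
  then show ?thesis
    by (auto simp: overlinings_def nth_append less_Suc_eq all_conj_distrib)
qed

lemma overlinings_snoc:
  "overlinings (ys @ [y]) =
     (\<lambda>xs. xs @ [(y, False)]) ` overlinings ys \<union>
     (if y \<in> set ys then {} else (\<lambda>xs. xs @ [(y, True)]) ` overlinings ys)"
  (is "?L = ?R")
proof (rule set_eqI)
  fix zs
  show "zs \<in> ?L \<longleftrightarrow> zs \<in> ?R"
  proof (cases zs rule: rev_cases)
    case Nil
    then show ?thesis by (auto simp: overlinings_def)
  next
    case (snoc xs x)
    obtain z b where "x = (z, b)" by (cases x)
    with snoc show ?thesis
      by (cases b) (auto simp: snoc_mem_overlinings_iff)
  qed
qed

text \<open>Induction from the right: a repeated size can only be appended without a bar, so the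
  count stays; a new size can be appended with or without one, so the count doubles.\<close>

lemma finite_card_overlinings:
  "finite (overlinings ys) \<and> card (overlinings ys) = 2 ^ card (set ys)"
proof (induction ys rule: rev_induct)
  case Nil
  have "overlinings [] = {[]}" by (auto simp: overlinings_def)
  then show ?case by simp
next
  case (snoc y ys)
  have inj: "inj_on (\<lambda>xs. xs @ [(y, b)]) (overlinings ys)" for b
    by (auto simp: inj_on_def)
  show ?case
  proof (cases "y \<in> set ys")
    case True
    with snoc inj show ?thesis
      by (simp add: overlinings_snoc card_image insert_absorb)
  next
    case False
    have "(\<lambda>xs. xs @ [(y, False)]) ` overlinings ys
        \<inter> (\<lambda>xs. xs @ [(y, True)]) ` overlinings ys = {}"
      by auto
    with False snoc inj show ?thesis
      by (simp add: overlinings_snoc card_image card_Un_disjoint)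
  qed
qed

lemma odd_overpartitions_eq_UN:
  "odd_overpartitions n = (\<Union>ys\<in>odd_partitions n. overlinings ys)"
  by (force simp: odd_overpartitions_def odd_partitions_def overlinings_def overpartition_def
      odd_parts_def intro: odd_pos)

lemma finite_odd_overpartitions: "finite (odd_overpartitions n)"
proof (rule finite_subset)
  show "odd_overpartitions n \<subseteq> {xs. set xs \<subseteq> {..n} \<times> UNIV \<and> length xs \<le> n}"
    using overpartition_bounded by (fastforce simp: odd_overpartitions_def)
qed (intro finite_lists_length_le finite_cartesian_product; simp)

lemma finite_odd_partitions: "finite (odd_partitions n)"
proof (rule finite_subset)
  \<comment> \<open>Every partition is the projection of its overpartition without bars, so
    finiteness passes from overpartitions to partitions.\<close>
  have "ys = map fst (map (\<lambda>y. (y, False)) ys)" for ys :: "nat list"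
    by (simp add: comp_def)
  moreover have "map (\<lambda>y. (y, False)) ys \<in> odd_overpartitions n" if "ys \<in> odd_partitions n" for ys
    using that
    by (auto simp: odd_overpartitions_def odd_partitions_def overpartition_def odd_parts_def
        comp_def odd_pos)
  ultimately show "odd_partitions n \<subseteq> map fst ` odd_overpartitions n"
    by blast
qed (simp add: finite_odd_overpartitions)

lemma card_odd_overpartitions:
  "card (odd_overpartitions n) = (\<Sum>ys\<in>odd_partitions n. 2 ^ card (set ys))"
proof -
  have "overlinings ys \<inter> overlinings zs = {}" if "ys \<noteq> zs" for ys zs
    using that by (auto simp: overlinings_def)
  then show ?thesis
    unfolding odd_overpartitions_eq_UN
    by (subst card_UN_disjoint) (simp_all add: finite_odd_partitions finite_card_overlinings)
qed

lemma odd_overpartitions_0: "odd_overpartitions 0 = {[]}"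
proof -
  have "xs = []" if "xs \<in> odd_overpartitions 0" for xs
    using that overpartition_bounded(1)[of 0 xs] by (simp add: odd_overpartitions_def)
  then show ?thesis
    by (auto simp: odd_overpartitions_def overpartition_def odd_parts_def)
qed

section \<open>Odd overpartitions modulo 2 and 4\<close>

lemma card_set_odd_partition_pos:
  assumes "ys \<in> odd_partitions n" "n > 0"
  shows "card (set ys) > 0"
proof -
  have "ys \<noteq> []" using assms unfolding odd_partitions_def by force
  then show ?thesis by (simp add: card_gt_0_iff)
qed

lemma even_card_odd_overpartitions:
  assumes "n > 0"
  shows "even (card (odd_overpartitions n))"
  unfolding card_odd_overpartitions
proof (rule dvd_sum)
  fix ys assume "ys \<in> odd_partitions n"
  then have "card (set ys) > 0" using assms by (rule card_set_odd_partition_pos)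
  then show "(2::nat) dvd 2 ^ card (set ys)" by (rule dvd_power[OF disjI1])
qed

text \<open>A partition with one part size \<open>d\<close> consists of \<open>n div d\<close>
  copies of \<open>d\<close>, so it corresponds to the divisor \<open>d\<close>. Since
  \<open>n\<close> is odd, all its divisors are admissible parts.\<close>

lemma card_single_size_odd_partitions:
  assumes "odd n"
  shows "card {ys \<in> odd_partitions n. card (set ys) = 1} = card {d. d dvd n}"
proof -
  have n: "n > 0" using assms by (rule odd_pos)
  have "bij_betw (\<lambda>d. replicate (n div d) d) {d. d dvd n}
          {ys \<in> odd_partitions n. card (set ys) = 1}"
  proof (rule bij_betw_imageI)
    \<comment> \<open>Needed for injectivity: \<open>replicate 0 d\<close> would be the empty list
      for every \<open>d\<close>.\<close>
    have "n div d > 0" if "d dvd n" for d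
      using that n by (metis dvd_div_eq_0_iff gr0I less_irrefl)
    then show "inj_on (\<lambda>d. replicate (n div d) d) {d. d dvd n}"
      by (auto simp: inj_on_def replicate_eq_replicate)
    show "(\<lambda>d. replicate (n div d) d) ` {d. d dvd n} =
        {ys \<in> odd_partitions n. card (set ys) = 1}" (is "?f ` _ = ?Y")
    proof (intro equalityI subsetI)
      fix ys assume "ys \<in> ?f ` {d. d dvd n}"
      then obtain d where d: "d dvd n" and ys: "ys = ?f d" by auto
      have "n div d \<noteq> 0" using d n by (simp add: dvd_div_eq_0_iff)
      moreover have "odd d" using d assms by (meson dvd_trans)
      ultimately show "ys \<in> ?Y"
        using d by (auto simp: ys odd_partitions_def sum_list_replicate sorted_wrt_iff_nth_less)
    next
      fix ys assume ys: "ys \<in> ?Y"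
      then obtain d where d: "set ys = {d}" by (auto simp: card_1_singleton_iff)
      then have rep: "ys = replicate (length ys) d"
        by (metis empty_iff insertE replicate_eqI)
      have "sum_list ys = length ys * d"
        by (subst rep) (simp add: sum_list_replicate)
      with ys have len: "n = length ys * d" by (simp add: odd_partitions_def)
      with n have "n div d = length ys" by simp
      with rep have "ys = ?f d" by simp
      moreover have "d dvd n" by (simp add: len)
      ultimately show "ys \<in> ?f ` {d. d dvd n}" by blast
    qed
  qed
  then show ?thesis by (simp add: bij_betw_same_card)
qed

text \<open>In the sum of the powers \<open>2 ^ card (set ys)\<close>, two or more part sizes give a
  multiple of 4, and a single size gives 2.\<close>

lemma card_odd_overpartitions_cong:
  assumes "odd n"
  shows "[card (odd_overpartitions n) = 2 * card {d. d dvd n}] (mod 4)"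
proof -
  have n: "n > 0" using assms by (rule odd_pos)
  have "[(\<Sum>ys\<in>odd_partitions n. 2 ^ card (set ys)) =
         (\<Sum>ys\<in>odd_partitions n. if card (set ys) = 1 then 2 else 0 :: nat)] (mod 4)"
  proof (rule cong_sum)
    fix ys assume "ys \<in> odd_partitions n"
    then have "card (set ys) > 0" using n by (rule card_set_odd_partition_pos)
    moreover have "(4::nat) dvd 2 ^ m" if "m \<ge> 2" for m
      using le_imp_power_dvd[OF that, of "2::nat"] by simp
    ultimately show "[2 ^ card (set ys) = (if card (set ys) = 1 then 2 else 0 :: nat)] (mod 4)"
      by (cases "card (set ys) = 1") (auto simp: cong_0_iff)
  qed
  also have "(\<Sum>ys\<in>odd_partitions n. if card (set ys) = 1 then 2 else 0 :: nat) =
      2 * card {ys \<in> odd_partitions n. card (set ys) = 1}"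
    by (simp add: finite_odd_partitions flip: sum.inter_filter)
  finally show ?thesis
    unfolding card_odd_overpartitions card_single_size_odd_partitions[OF assms] .
qed

section \<open>Tuples as convolutions, modulo 4\<close>

lemma odd_overpartitions_sum: "xs \<in> odd_overpartitions n \<Longrightarrow> sum_list (map fst xs) = n"
  by (simp add: odd_overpartitions_def overpartition_def)

lemma overpartition_tuples_odd_iff:
  "\<xi>s \<in> overpartition_tuples_odd k n \<longleftrightarrow>
     length \<xi>s = k \<and> (\<forall>\<xi>\<in>set \<xi>s. \<exists>m. \<xi> \<in> odd_overpartitions m) \<and>
     (\<Sum>\<xi>\<leftarrow>\<xi>s. sum_list (map fst \<xi>)) = n"
  by (simp add: overpartition_tuples_odd_def odd_overpartitions_def)

lemma overpartition_tuples_odd_Suc: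
  "overpartition_tuples_odd (Suc k) n =
     (\<Union>i\<in>{..n}. (\<lambda>(\<xi>, \<xi>s). \<xi> # \<xi>s) ` (odd_overpartitions i \<times> overpartition_tuples_odd k (n - i)))"
  (is "?L = ?R")
proof (intro equalityI subsetI)
  fix \<zeta>s assume L: "\<zeta>s \<in> ?L"
  then obtain \<xi> \<xi>s where \<zeta>s: "\<zeta>s = \<xi> # \<xi>s"
    by (cases \<zeta>s) (auto simp: overpartition_tuples_odd_iff)
  with L obtain i where i: "\<xi> \<in> odd_overpartitions i"
    by (auto simp: overpartition_tuples_odd_iff)
  with L have "i \<le> n" and "\<xi>s \<in> overpartition_tuples_odd k (n - i)"
    using odd_overpartitions_sum[OF i] by (auto simp: overpartition_tuples_odd_iff \<zeta>s)
  with i show "\<zeta>s \<in> ?R"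
    by (force simp: \<zeta>s)
next
  fix \<xi>s assume "\<xi>s \<in> ?R"
  then show "\<xi>s \<in> ?L"
    by (auto simp: overpartition_tuples_odd_iff dest: odd_overpartitions_sum)
qed

lemma OPT_0: "OPT 0 n = (if n = 0 then 1 else 0)"
proof -
  have "overpartition_tuples_odd 0 n = (if n = 0 then {[]} else {})"
    by (auto simp: overpartition_tuples_odd_def)
  then show ?thesis by (simp add: OPT_def)
qed

text \<open>This is multiplication of generating functions. The union over \<open>i\<close> is
  disjoint because the sum of the first overpartition recovers \<open>i\<close>.\<close>

lemma OPT_Suc: "OPT (Suc k) n = (\<Sum>i\<le>n. card (odd_overpartitions i) * OPT k (n - i))"
proof -
  have "inj_on (\<lambda>(\<xi>, \<xi>s). \<xi> # \<xi>s) A" for A :: "((nat \<times> bool) list \<times> (nat \<times> bool) list list) set"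
    by (auto simp: inj_on_def)
  then show ?thesis
    unfolding OPT_def overpartition_tuples_odd_Suc
    by (subst card_UN_disjoint)
      (auto simp: finite_odd_overpartitions finite_overpartition_tuples_odd card_image
        card_cartesian_product dest: odd_overpartitions_sum)
qed

lemma OPT_n_0: "OPT k 0 = 1"
  by (induction k) (simp_all add: OPT_0 OPT_Suc odd_overpartitions_0)

text \<open>Induction on \<open>k\<close> by the convolution: the end terms \<open>i = 0\<close> and
  \<open>i = n\<close> give \<open>OPT k n\<close> and one further copy of the single count, while
  each interior term is a product of two even numbers.\<close>

lemma OPT_cong:
  assumes "n > 0"
  shows "[OPT k n = k * card (odd_overpartitions n)] (mod 4)"
  using assms
proof (induction k arbitrary: n)
  case 0
  then show ?case by (simp add: OPT_0)
next
  case (Suc k)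
  let ?a = "\<lambda>i. card (odd_overpartitions i)"
  have "[(\<Sum>i\<in>{0<..<n}. ?a i * OPT k (n - i)) = 0] (mod 4)"
  proof (subst cong_0_iff, rule dvd_sum)
    fix i assume i: "i \<in> {0<..<n}"
    then have "even (?a i)" by (simp add: even_card_odd_overpartitions)
    moreover have "even (OPT k (n - i))"
    proof -
      \<comment> \<open>The induction hypothesis at \<open>n - i > 0\<close>, weakened to modulus 2,
        reduces the parity to that of a single count.\<close>
      have "[OPT k (n - i) = k * ?a (n - i)] (mod 2)"
        using i by (intro cong_dvd_modulus_nat[of _ _ 4 2] Suc.IH) auto
      then show ?thesis
        using i by (simp add: cong_dvd_iff even_card_odd_overpartitions)
    qed
    ultimately have "2 * 2 dvd ?a i * OPT k (n - i)" by (rule mult_dvd_mono)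
    then show "4 dvd ?a i * OPT k (n - i)" by simp
  qed
  then have "[OPT k n + (\<Sum>i\<in>{0<..<n}. ?a i * OPT k (n - i)) + ?a n = k * ?a n + 0 + ?a n] (mod 4)"
    using Suc by (intro cong_add cong_refl) auto
  moreover have "{..n} = insert 0 (insert n {0<..<n})" using Suc.prems by auto
  then have "OPT (Suc k) n = OPT k n + (\<Sum>i\<in>{0<..<n}. ?a i * OPT k (n - i)) + ?a n"
    using Suc.prems by (simp add: OPT_Suc odd_overpartitions_0 OPT_n_0)
  ultimately show ?case by (simp add: add.commute)
qed

section \<open>Divisor counts and non-squares\<close>

text \<open>The involution sending \<open>d\<close> to \<open>n div d\<close> pairs the divisors; a
  fixed point would make \<open>n\<close> the square of \<open>d\<close>.\<close>

lemma even_card_divisors: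
  fixes n :: nat
  assumes "n > 0" and nonsquare: "\<And>r. n \<noteq> r ^ 2"
  shows "even (card {d. d dvd n})"
proof -
  let ?S = "{d. d dvd n \<and> d < n div d}" and ?G = "{d. d dvd n \<and> n div d < d}"
  have fin: "finite {d. d dvd n}" using assms(1) by simp
  have "d \<noteq> n div d" if "d dvd n" for d
    using that nonsquare[of d] by (metis dvd_mult_div_cancel power2_eq_square)
  then have "{d. d dvd n} = ?S \<union> ?G" by force
  then have "card {d. d dvd n} = card (?S \<union> ?G)" by (rule arg_cong)
  also have "card (?S \<union> ?G) = card ?S + card ?G"
    by (rule card_Un_disjoint) (auto intro: finite_subset[OF _ fin])
  finally have card: "card {d. d dvd n} = card ?S + card ?G" .
  have inv: "n div (n div d) = d" if "d dvd n" for d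
    using that assms(1) by (metis dvd_mult_div_cancel div_mult_self_is_m mult_is_0 gr0I)
  have dvd: "n div d dvd n" if "d dvd n" for d
    using that by (metis dvd_triv_right dvd_mult_div_cancel)
  have "bij_betw (\<lambda>d. n div d) ?S ?G"
  proof (rule bij_betw_byWitness[where f' = "\<lambda>d. n div d"])
    show "(\<lambda>d. n div d) ` ?S \<subseteq> ?G" and "(\<lambda>d. n div d) ` ?G \<subseteq> ?S"
      using inv dvd by force+
  qed (use inv in blast)+
  then have "card ?S = card ?G" by (rule bij_betw_same_card)
  with card show ?thesis by presburger
qed

lemma OPT_cong_0_mod_4:
  assumes "odd n" and "\<And>r. n \<noteq> r ^ 2"
  shows "[OPT k n = 0] (mod 4)"
proof -
  have n: "n > 0" using assms(1) by (rule odd_pos)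
  have "[OPT k n = k * card (odd_overpartitions n)] (mod 4)" using n by (rule OPT_cong)
  also have "[k * card (odd_overpartitions n) = k * (2 * card {d. d dvd n})] (mod 4)"
    using assms(1) by (intro cong_scalar_left card_odd_overpartitions_cong)
  also have "[k * (2 * card {d. d dvd n}) = 0] (mod 4)"
    using even_card_divisors[OF n assms(2)] by (auto simp: cong_0_iff elim!: evenE)
  finally show ?thesis .
qed

text \<open>Cancelling \<open>c ^ 2\<close> would make \<open>p * m\<close> a square; then
  \<open>p\<close> divides its root, so \<open>p ^ 2\<close> divides \<open>p * m\<close> and
  \<open>p\<close> divides \<open>m\<close>.\<close>

lemma square_mult_prime_not_square:
  fixes p c m :: nat
  assumes "prime p" "\<not> p dvd m" "c > 0"
  shows "c ^ 2 * (p * m) \<noteq> r ^ 2"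
proof
  assume eq: "c ^ 2 * (p * m) = r ^ 2"
  then have "c dvd r" by (metis dvd_triv_left pow_divides_pow_iff zero_less_numeral)
  then obtain s where "r = c * s" ..
  with eq assms(3) have s: "p * m = s ^ 2" by (simp add: power_mult_distrib)
  then have "p dvd s ^ 2" by (metis dvd_triv_left)
  with assms(1) have "p dvd s" by (rule prime_dvd_power)
  then have "p * p dvd p * m" unfolding s power2_eq_square by (intro mult_dvd_mono)
  with assms show False by (simp add: prime_gt_0_nat)
qed

theorem theorem2p12:
  fixes p n \<alpha> \<delta> k t :: nat
  assumes "prime p" and "p \<ge> 3" and "k \<ge> 1" and "t \<in> {1..p - 1}"
  shows "[OPT (2 * k + 1)
            (2 * 3 ^ (2 * \<alpha>) * p ^ (2 * \<delta> + 1) * (p * n + t)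
              + 3 ^ (2 * \<alpha>) * p ^ (2 * (\<delta> + 1))) = 0] (mod 4)"
proof -
  \<comment> \<open>Both summands share the factor \<open>?c ^ 2 * p\<close>; what remains of them
    is \<open>2 * (p * n + t)\<close> and \<open>p\<close>, whose sum is \<open>?m\<close>.\<close>
  let ?c = "3 ^ \<alpha> * p ^ \<delta>" and ?m = "2 * (p * n + t) + p"
  have square: "?c ^ 2 = 3 ^ (2 * \<alpha>) * p ^ (2 * \<delta>)"
    by (simp add: power_mult_distrib mult.commute flip: power_mult)
  have N: "2 * 3 ^ (2 * \<alpha>) * p ^ (2 * \<delta> + 1) * (p * n + t) + 3 ^ (2 * \<alpha>) * p ^ (2 * (\<delta> + 1))
      = ?c ^ 2 * (p * ?m)"
    unfolding square by (simp add: algebra_simps)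
  have "odd p" using assms by (simp add: prime_odd_nat)
  have "\<not> p dvd t" using assms by (auto dest: dvd_imp_le)
  moreover have "\<not> p dvd 2" using assms(2) by (auto dest: dvd_imp_le)
  ultimately have "\<not> p dvd 2 * t" using assms(1) by (simp add: prime_dvd_mult_iff)
  \<comment> \<open>Collecting the multiples of \<open>p\<close> shows that \<open>?m\<close> is
    congruent to \<open>2 * t\<close> modulo \<open>p\<close>.\<close>
  moreover have "?m = 2 * t + p * (2 * n + 1)" by (simp add: algebra_simps)
  ultimately have "\<not> p dvd ?m" by (metis dvd_add_left_iff dvd_triv_left)
  then have "\<And>r. ?c ^ 2 * (p * ?m) \<noteq> r ^ 2"
    using assms by (intro square_mult_prime_not_square) auto
  \<comment> \<open>Here \<open>?m\<close> is odd as an even number plus the odd prime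
    \<open>p\<close>.\<close>
  moreover have "odd (?c ^ 2 * (p * ?m))" using \<open>odd p\<close> by simp
  ultimately show ?thesis unfolding N by (intro OPT_cong_0_mod_4)
qed

end
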